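(* Let $k\geq 1$ be an integer. Then every graph in $\mathbf{Forb}_{\mathrm{mz}\leq k}$ has at most $2k+2$ vertices.
   Context: All graphs are finite and simple. Zero forcing: each vertex of a graph $G$ is blue or white. Color change rule: if $x$ is a blue vertex and $y$ is the only white neighbor of $x$, then $y$ turns blue. A set $B\subseteq V(G)$ is a zero forcing set if, starting with exactly the vertices of $B$ blue, all vertices of $G$ can be made blue by repeated applications of the rule. The zero forcing number $Z(G)$ is the minimum cardinality of a zero forcing set of $G$, and $\mathrm{mz}(G)=|V(G)|-Z(G)$. A graph $H$ is forbidden for graphs with $\mathrm{mz}\leq k$ if $\mathrm{mz}(H)\geq k+1$. $\mathbf{Forb}_{\mathrm{mz}\leq k}$ denotes the set of graphs (up to isomorphism) that are forbidden for graphs with $\mathrm{mz}\leq k$ and are minimal with this property under taking induced subgraphs, i.e. $\mathrm{mz}(H)\geq k+1$ and $\mathrm{mz}(H')\leq k$ for every proper induced subgraph $H'$ of $H$. *)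

theory Defs
  imports "Graph_Theory.Graph_Theory"
begin

text \<open>
  Finite simple graphs are modelled by the locale \<^locale>\<open>pair_graph\<close>: a finite vertex set
  \<^term>\<open>pverts G\<close> with a symmetric, irreflexive adjacency relation \<^term>\<open>parcs G\<close>.
\<close>

text \<open>
  \<open>color_change G B B'\<close>: one application of the color change rule leads from the set \<open>B\<close> of
  blue vertices to \<open>B'\<close>.
\<close>

inductive color_change :: "'a pair_pre_digraph \<Rightarrow> 'a set \<Rightarrow> 'a set \<Rightarrow> bool"
  for G :: "'a pair_pre_digraph" where
  force: "x \<in> B \<Longrightarrow> {z. (x, z) \<in> parcs G \<and> z \<notin> B} = {y} \<Longrightarrow> color_change G B (insert y B)"

definition zero_forcing_set :: "'a pair_pre_digraph \<Rightarrow> 'a set \<Rightarrow> bool" where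
  "zero_forcing_set G B \<longleftrightarrow> B \<subseteq> pverts G \<and> (color_change G)\<^sup>*\<^sup>* B (pverts G)"

definition zero_forcing_number :: "'a pair_pre_digraph \<Rightarrow> nat" where
  "zero_forcing_number G = (LEAST n. \<exists>B. zero_forcing_set G B \<and> card B = n)"

definition mz :: "'a pair_pre_digraph \<Rightarrow> nat" where
  "mz G = card (pverts G) - zero_forcing_number G"

text \<open>The minimum exists, and the subtraction on \<^typ>\<open>nat\<close> above never truncates.\<close>

lemma zero_forcing_set_pverts: "zero_forcing_set G (pverts G)"
  by (simp add: zero_forcing_set_def)

lemma zero_forcing_number_le_card: "zero_forcing_number G \<le> card (pverts G)"
  unfolding zero_forcing_number_def
  by (rule Least_le) (use zero_forcing_set_pverts in blast)

definition forbidden_mz :: "nat \<Rightarrow> 'a pair_pre_digraph \<Rightarrow> bool" where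
  "forbidden_mz k H \<longleftrightarrow> mz H \<ge> k + 1"

text \<open>
  Instead of isomorphism classes, the set contains all their representatives with vertices in
  \<^typ>\<open>'a\<close>.
\<close>

definition Forb_mz :: "nat \<Rightarrow> 'a pair_pre_digraph set" where
  "Forb_mz k = {H. pair_graph H \<and> forbidden_mz k H \<and>
     (\<forall>H'. induced_subgraph (with_proj H') (with_proj H) \<and> H' \<noteq> H \<longrightarrow> mz H' \<le> k)}"

end

theory Submission
  imports Defs
begin

text \<open>
  A graph with \<open>mz \<ge> m\<close> admits a run of exactly \<open>m\<close> forces that turns every vertex blue: drop the
  initial forces of a run from a minimum zero forcing set. Every one of these forces survives in
  the subgraph induced by the vertices that force and the vertices that are forced. So that
  subgraph, with at most \<open>2 * m\<close> vertices, also has \<open>mz \<ge> m\<close>, and by minimality it is all of \<open>H\<close>.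
\<close>

lemma card_Diff_insert_Suc:
  assumes "finite V" "y \<in> V" "y \<notin> B"
  shows "card (V - B) = Suc (card (V - insert y B))"
proof -
  have "Suc (card (V - B - {y})) = card (V - B)"
    using assms by (intro card_Suc_Diff1) auto
  moreover have "V - B - {y} = V - insert y B" by blast
  ultimately show ?thesis by metis
qed

context pair_fin_digraph
begin

text \<open>The rule \<open>force\<close> does not mention \<open>pverts G\<close>; \<open>x\<close>
  and \<open>y\<close> are vertices because they are the ends of an arc.\<close>

lemma color_changeE:
  assumes "color_change G B C"
  obtains x y where "x \<in> B" "x \<in> pverts G" "y \<in> pverts G" "y \<notin> B"
    "{z. (x, z) \<in> parcs G \<and> z \<notin> B} = {y}" "C = insert y B"
  using assms
proof cases
  case (force x y)
  then have "(x, y) \<in> parcs G" "y \<notin> B" by auto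
  with force in_arcsD1 in_arcsD2 show thesis by (intro that[of x y])
qed

text \<open>Each force lowers the number of white vertices by exactly one, down to 0 at the end of
  the run, so the run passes through a set with exactly \<open>m\<close> white vertices.\<close>

lemma forcing_suffix:
  assumes "(color_change G)\<^sup>*\<^sup>* B (pverts G)" "m \<le> card (pverts G - B)"
  obtains B' where "(color_change G)\<^sup>*\<^sup>* B' (pverts G)" "card (pverts G - B') = m"
  using assms
proof (induction arbitrary: thesis rule: converse_rtranclp_induct)
  case base
  show ?case using base(2) by (intro base(1)[of "pverts G"]) auto
next
  case (step B C)
  show ?case
  proof (cases "card (pverts G - B) = m")
    case True
    with step.hyps show ?thesis
      by (intro step.prems(1)[of B]) (auto intro: converse_rtranclp_into_rtranclp)
  next
    case False
    obtain y where "y \<in> pverts G" "y \<notin> B" "C = insert y B"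
      using step.hyps(1) by (elim color_changeE) (rule that)
    then have "card (pverts G - B) = Suc (card (pverts G - C))"
      using card_Diff_insert_Suc[of "pverts G" y B] by simp
    \<comment> \<open>Here \<open>B\<close> has strictly more than \<open>m\<close> white vertices,
      so losing one still leaves at least \<open>m\<close>.\<close>
    with False step.prems(2) have "m \<le> card (pverts G - C)" by simp
    with step.IH step.prems(1) show ?thesis by blast
  qed
qed

text \<open>A force from \<open>x\<close> to \<open>y\<close> stays valid in any induced subgraph
  containing both: deleting vertices can only take white neighbors away from \<open>x\<close>, and
  \<open>y\<close> is kept. All deleted vertices lie in \<open>B\<close>.\<close>

lemma forcing_core:
  assumes "(color_change G)\<^sup>*\<^sup>* B (pverts G)"
  obtains U where "U \<subseteq> pverts G" "pverts G - B \<subseteq> U" "card U \<le> 2 * card (pverts G - B)"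
    "(color_change \<lparr>pverts = U, parcs = parcs G \<inter> U \<times> U\<rparr>)\<^sup>*\<^sup>* (B \<inter> U) U"
proof -
  \<comment> \<open>Quantifying over all \<open>W \<supseteq> U\<close> lets \<open>U\<close> grow by two vertices in each induction step.\<close>
  have "\<exists>U. U \<subseteq> pverts G \<and> pverts G - B \<subseteq> U \<and> card U \<le> 2 * card (pverts G - B) \<and>
    (\<forall>W. U \<subseteq> W \<and> W \<subseteq> pverts G \<longrightarrow>
      (color_change \<lparr>pverts = W, parcs = parcs G \<inter> W \<times> W\<rparr>)\<^sup>*\<^sup>* (B \<inter> W) W)"
    using assms
  proof (induction rule: converse_rtranclp_induct)
    case base
    show ?case by (intro exI[of _ "{}"]) (auto simp: Int_absorb1)
  next
    case (step B C)
    from step.hyps(1) obtain x y where x: "x \<in> B" "x \<in> pverts G" and y: "y \<in> pverts G" "y \<notin> B"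
      and white: "{z. (x, z) \<in> parcs G \<and> z \<notin> B} = {y}" and C: "C = insert y B"
      by (rule color_changeE)
    have card: "card (pverts G - B) = Suc (card (pverts G - C))"
      using y C card_Diff_insert_Suc[of "pverts G" y B] by simp
    from step.IH obtain U where U: "U \<subseteq> pverts G" "pverts G - C \<subseteq> U" "card U \<le> 2 * card (pverts G - C)"
      and run: "\<forall>W. U \<subseteq> W \<and> W \<subseteq> pverts G \<longrightarrow>
        (color_change \<lparr>pverts = W, parcs = parcs G \<inter> W \<times> W\<rparr>)\<^sup>*\<^sup>* (C \<inter> W) W"
      by (elim exE conjE)
    show ?case
    proof (intro exI[of _ "insert x (insert y U)"] conjI allI impI)
      show "insert x (insert y U) \<subseteq> pverts G" using U(1) x y by simp
      show "pverts G - B \<subseteq> insert x (insert y U)" using U(2) C by blast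
      \<comment> \<open>Two vertices at most are added for the one extra white vertex
        \<open>y\<close>; \<open>x\<close> may already lie in \<open>U\<close>.\<close>
      show "card (insert x (insert y U)) \<le> 2 * card (pverts G - B)"
        using U(3) card by (simp add: card_insert_if finite_subset[OF U(1)])
    next
      fix W assume W: "insert x (insert y U) \<subseteq> W \<and> W \<subseteq> pverts G"
      then have "{z. (x, z) \<in> parcs G \<inter> W \<times> W \<and> z \<notin> B \<inter> W} = {z. (x, z) \<in> parcs G \<and> z \<notin> B} \<inter> W"
        by auto
      also have "\<dots> = {y}" using white W by simp
      finally have "color_change \<lparr>pverts = W, parcs = parcs G \<inter> W \<times> W\<rparr> (B \<inter> W) (insert y (B \<inter> W))"
        using x W by (intro color_change.force[of x]) simp_all
      moreover have "insert y (B \<inter> W) = C \<inter> W" using C W by simp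
      moreover have "(color_change \<lparr>pverts = W, parcs = parcs G \<inter> W \<times> W\<rparr>)\<^sup>*\<^sup>* (C \<inter> W) W"
        using run W by simp
      ultimately show "(color_change \<lparr>pverts = W, parcs = parcs G \<inter> W \<times> W\<rparr>)\<^sup>*\<^sup>* (B \<inter> W) W"
        by (metis converse_rtranclp_into_rtranclp)
    qed
  qed
  \<comment> \<open>The required run is the case \<open>W = U\<close>.\<close>
  then show thesis by (elim exE conjE, intro that) auto
qed

lemma ex_small_induced_subgraph:
  assumes "m \<le> mz G"
  obtains H where "induced_subgraph (with_proj H) (with_proj G)"
    "card (pverts H) \<le> 2 * m" "m \<le> mz H"
proof -
  have "\<exists>B. zero_forcing_set G B \<and> card B = zero_forcing_number G"
    unfolding zero_forcing_number_def
    by (rule LeastI_ex) (use zero_forcing_set_pverts in blast)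
  then obtain B where "zero_forcing_set G B" and B: "card B = zero_forcing_number G"
    by (elim exE conjE)
  then have "B \<subseteq> pverts G" and B_run: "(color_change G)\<^sup>*\<^sup>* B (pverts G)"
    by (auto simp: zero_forcing_set_def)
  \<comment> \<open>Since \<open>B\<close> has minimum size, its number of white vertices is exactly
    \<open>mz G\<close>.\<close>
  then have "m \<le> card (pverts G - B)"
    using assms B by (simp add: mz_def card_Diff_subset finite_subset)
  with B_run obtain B'
    where B': "(color_change G)\<^sup>*\<^sup>* B' (pverts G)" "card (pverts G - B') = m"
    by (rule forcing_suffix)
  obtain U where U: "U \<subseteq> pverts G" "pverts G - B' \<subseteq> U" "card U \<le> 2 * card (pverts G - B')"
    and run: "(color_change \<lparr>pverts = U, parcs = parcs G \<inter> U \<times> U\<rparr>)\<^sup>*\<^sup>* (B' \<inter> U) U"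
    using B'(1) by (rule forcing_core)
  define H where "H = \<lparr>pverts = U, parcs = parcs G \<inter> U \<times> U\<rparr>"
  have "zero_forcing_set H (B' \<inter> U)"
    using run by (simp add: zero_forcing_set_def H_def)
  then have "zero_forcing_number H \<le> card (B' \<inter> U)"
    unfolding zero_forcing_number_def by (intro Least_le) blast
  \<comment> \<open>\<open>U\<close> contains every vertex outside \<open>B'\<close>, so restricting
    to \<open>U\<close> loses only blue vertices, and \<open>m\<close> vertices of \<open>H\<close>
    are still white at the start.\<close>
  moreover have "card U = card (B' \<inter> U) + m"
  proof -
    have "U = (B' \<inter> U) \<union> (pverts G - B')" using U by blast
    moreover have "finite U" using finite_subset[OF U(1)] by simp
    ultimately show ?thesis
      using B'(2) card_Un_disjoint[of "B' \<inter> U" "pverts G - B'"] by auto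
  qed
  ultimately have "m \<le> mz H" by (simp add: mz_def H_def)
  moreover have "induced_subgraph (with_proj H) (with_proj G)"
  proof -
    have "wf_digraph (with_proj H)" by unfold_locales (auto simp: H_def)
    then show ?thesis
      using U(1) wf_digraph_axioms
      by (auto simp: H_def induced_subgraph_def subgraph_def compatible_def)
  qed
  moreover have "card (pverts H) \<le> 2 * m" using U(3) B'(2) by (simp add: H_def)
  ultimately show thesis using that by blast
qed

end

theorem theorem5:
  fixes k :: nat and H :: "'a pair_pre_digraph"
  assumes "k \<ge> 1"
    and "H \<in> Forb_mz k"
  shows "card (pverts H) \<le> 2 * k + 2"
proof -
  from assms(2) interpret pair_graph H by (simp add: Forb_mz_def)
  have "k + 1 \<le> mz H" using assms(2) by (simp add: Forb_mz_def forbidden_mz_def)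
  \<comment> \<open>Taking \<open>m = k + 1\<close> keeps \<open>H'\<close> forbidden, so minimality
    of \<open>H\<close> rules out that \<open>H'\<close> is proper.\<close>
  then obtain H' where H': "induced_subgraph (with_proj H') (with_proj H)"
    "card (pverts H') \<le> 2 * (k + 1)" "k + 1 \<le> mz H'"
    by (rule ex_small_induced_subgraph)
  have "H' = H"
  proof (rule ccontr)
    assume "H' \<noteq> H"
    with assms(2) H'(1) have "mz H' \<le> k" by (simp add: Forb_mz_def)
    with H'(3) show False by simp
  qed
  with H'(2) show ?thesis by simp
qed

end
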